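(* Consider the system $x(t+1)=Ax(t)+Bu(t)+w(t)$, $y(t)=Cx(t)+Du(t)$, with $w(t)\in\mathcal{W}$ for all $t$, subject to the constraints $x(t)\in\mathcal{X}$, $u(t)\in\mathcal{U}$, and controlled in closed loop by the RSSA-MPC law $u(t)=\bar u^\ast(0|t)+K\big(x(t)-\bar x_0^\ast(t)\big)$, where $\big(\theta^\ast(t),\bar x_0^\ast(t),\mathbf{\bar u}^\ast(t)\big)$ is an optimal solution of the RSSA-MPC optimization problem $\mathcal{P}(x(t))$ defined in the context. Assume that $\mathcal{P}(x(t_0))$ is feasible at a time instant $t_0\in\mathbb{Z}_{\ge 0}$. Then the problem $\mathcal{P}(x(t))$ remains feasible at all time instants $t\in\mathbb{Z}_{\geq 0}$ with $t\ge t_0$.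
   Context: Setting. $A\in\mathbb{R}^{n\times n}$, $B\in\mathbb{R}^{n\times p}$, $C\in\mathbb{R}^{m\times n}$, $D\in\mathbb{R}^{m\times p}$; the pair $(A,B)$ is stabilizable. The disturbance $w(t)\in\mathcal{W}\subset\mathbb{R}^n$ is unknown and bounded. $\mathcal{X}\subseteq\mathbb{R}^n$ and $\mathcal{U}\subseteq\mathbb{R}^p$ are convex and compact sets containing the origin. $K\in\mathbb{R}^{p\times n}$ is such that $A+BK$ is Schur (all eigenvalues in the open unit disc). Notation. $\|x\|_Q^2=x^\top Qx$; $X\oplus Y=\{x+y: x\in X,\ y\in Y\}$ (Minkowski sum); $X\ominus Y=\{x: x-y\in X\ \forall y\in Y\}$ (Pontryagin set difference, with this sign convention); for a point $v$, $v\oplus Y=\{v\}\oplus Y$; $K\mathcal{F}=\{Kf: f\in\mathcal{F}\}$. $\mathcal{F}_\infty=\bigoplus_{i=0}^\infty (A+BK)^i\mathcal{W}$ is the minimal robustly positively invariant set of the error dynamics $e(t+1)=(A+BK)e(t)+w(t)$, $w(t)\in\mathcal{W}$, where a set $\mathcal{F}$ is robustly positively invariant if $e\in\mathcal{F}$ and $w\in\mathcal{W}$ imply $(A+BK)e+w\in\mathcal{F}$. Steady states. The nominal system is $\bar x(t+1)=A\bar x(t)+B\bar u(t)$, $\bar y(t)=C\bar x(t)+D\bar u(t)$. $\mathcal{R}\subseteq\mathbb{R}^m$ is the set of references $r$ for which some $(\bar x_s,\bar u_s)\in\mathcal{X}\times\mathcal{U}$ satisfies $\bar x_s=A\bar x_s+B\bar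 u_s$ and $r=C\bar x_s+D\bar u_s$. Such steady-state configurations are parameterized as $\bar x_s=M_1\theta$, $\bar u_s=M_2\theta$, $r=L\theta$, with $M_1\in\mathbb{R}^{n\times n_\theta}$, $M_2\in\mathbb{R}^{p\times n_\theta}$, $L\in\mathbb{R}^{m\times n_\theta}$, $\theta\in\mathbb{R}^{n_\theta}$. A reference $r\in\mathcal{R}$ and a desired configuration $(\bar x_{\rm des},\bar u_{\rm des})\in\mathbb{R}^n\times\mathbb{R}^p$ are given. Weights. $Q_x\succeq0$, $Q_u\succ0$, $Q_r\succ0$, $Q_{sx}\succeq0$, $Q_{su}\succeq0$ are symmetric of appropriate sizes; $Q_N\succeq 0$ is the solution of the algebraic Riccati equation $Q_N=A^\top Q_NA-(A^\top Q_NB)(Q_u+B^\top Q_NB)^{-1}(B^\top Q_NA)+Q_x$; $K_\infty=-(Q_u+B^\top Q_NB)^{-1}B^\top Q_NA$, and $A+BK_\infty$ is Schur. The terminal control law is $\kappa(\bar x,\theta)=M_2\theta+K_\infty(\bar x-M_1\theta)$. Terminal set. Fix $\epsilon\in(0,1)$. $\mathcal{O}^\epsilon=\{\theta: M_1\theta\in(1-\epsilon)(\mathcal{X}\ominus\mathcal{F}_\infty),\ M_2\theta\in(1-\epsilon)(\mathcal{U}\ominus K\mathcal{F}_\infty)\}$. $\mathcal{O}_\infty$ is the set of $(\bar x,\theta)\in\mathbb{R}^n\times\mathbb{R}^{n_\theta}$ such that for all $\gamma=0,1,2,\dots$: $\hat{\bar x}(\gamma|\bar x,\theta)\in\mathcal{X}\ominus\mathcal{F}_\infty$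 and $M_2\theta+K_\infty(\hat{\bar x}(\gamma|\bar x,\theta)-M_1\theta)\in\mathcal{U}\ominus K\mathcal{F}_\infty$, where $\hat{\bar x}(\gamma|\bar x,\theta)=(A+BK_\infty)^\gamma\bar x+\sum_{i=1}^\gamma(A+BK_\infty)^{i-1}(BM_2-BK_\infty M_1)\theta$ is the nominal state after $\gamma$ steps from $\bar x$ under the terminal control law with $\theta$ kept constant. $\Omega=\mathcal{O}^\epsilon\cap\mathcal{O}_\infty$, meaning $\{(\bar x,\theta)\in\mathcal{O}_\infty:\theta\in\mathcal{O}^\epsilon\}$. RSSA-MPC (Robust Steady-State-Aware Model Predictive Control) problem. Let $N\in\mathbb{Z}_{>0}$. For $x(t)\in\mathbb{R}^n$, $\mathcal{P}(x(t))$ is: minimize over $\theta\in\mathbb{R}^{n_\theta}$, $\bar x_0\in\mathbb{R}^n$, $\mathbf{\bar u}=(\bar u(0|t),\dots,\bar u(N-1|t))\in(\mathbb{R}^p)^N$ the cost $$\sum_{k=0}^{N-1}\|\hat{\bar x}(k|t)-M_1\theta\|_{Q_x}^2+\sum_{k=0}^{N-1}\|\bar u(k|t)-M_2\theta\|_{Q_u}^2+\|\hat{\bar x}(N|t)-M_1\theta\|_{Q_N}^2+\|r-L\theta\|_{Q_r}^2+\|M_1\theta-\bar x_{\rm des}\|_{Q_{sx}}^2+\|M_2\theta-\bar u_{\rm des}\|_{Q_{su}}^2$$ subject to: $\hat{\bar x}(0|t)=\bar x_0$, $\hat{\bar x}(k+1|t)=A\hat{\bar x}(k|t)+B\bar u(k|t)$;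 $\bar x_0\in x(t)\oplus\mathcal{F}_\infty$; $\hat{\bar x}(k|t)\in\mathcal{X}\ominus\mathcal{F}_\infty$ and $\bar u(k|t)\in\mathcal{U}\ominus K\mathcal{F}_\infty$ for $k=0,\dots,N-1$; $(\hat{\bar x}(N|t),\theta)\in\Omega$. The problem is feasible if some $(\theta,\bar x_0,\mathbf{\bar u})$ satisfies all constraints; whenever it is feasible, $(\theta^\ast(t),\bar x_0^\ast(t),\mathbf{\bar u}^\ast(t))$ denotes a minimizer, which is taken to exist.
   Formalization: The disturbance set W is additionally assumed symmetric (W = −W); without this the claim fails, because the error x̄0 − x confined to F∞ evolves with −w while F∞ is invariant for +w (e.g. A=2, B=1, K=−2, W=[0,0.1], X=[−10,10], U=[−1,1], x=0.99). *)

theory Defs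
  imports "HOL-Analysis.Analysis"
begin

text \<open>The library power \<open>^\<close> on vectors of vectors is componentwise, so the matrix power is
  defined here.\<close>

primrec mat_power :: "'a::semiring_1^'n^'n \<Rightarrow> nat \<Rightarrow> 'a^'n^'n" where
  "mat_power M 0 = mat 1"
| "mat_power M (Suc k) = M ** mat_power M k"

definition eigenvalue :: "real^'n^'n \<Rightarrow> complex \<Rightarrow> bool" where
  "eigenvalue M z \<longleftrightarrow> (\<exists>v::complex^'n. v \<noteq> 0 \<and> map_matrix complex_of_real M *v v = z *s v)"

definition schur :: "real^'n^'n \<Rightarrow> bool" where
  "schur M \<longleftrightarrow> (\<forall>z. eigenvalue M z \<longrightarrow> cmod z < 1)"

definition stabilizable :: "real^'n^'n \<Rightarrow> real^'p^'n \<Rightarrow> bool" where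
  "stabilizable A B \<longleftrightarrow> (\<exists>G::real^'n^'p. schur (A + B ** G))"

definition wnorm2 :: "real^'n^'n \<Rightarrow> real^'n \<Rightarrow> real" where
  "wnorm2 Q v = v \<bullet> (Q *v v)"

definition pos_semidef :: "real^'n^'n \<Rightarrow> bool" where
  "pos_semidef Q \<longleftrightarrow> transpose Q = Q \<and> (\<forall>v. 0 \<le> v \<bullet> (Q *v v))"

definition pos_def :: "real^'n^'n \<Rightarrow> bool" where
  "pos_def Q \<longleftrightarrow> transpose Q = Q \<and> (\<forall>v. v \<noteq> 0 \<longrightarrow> 0 < v \<bullet> (Q *v v))"

text \<open>The Minkowski sum is the library's sum of sets (theory \<open>Set_Algebras\<close>). In the Pontryagin
  difference the second set is subtracted: many texts require \<open>x + y \<in> X\<close> instead.\<close>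

definition pontryagin_diff :: "'a::minus set \<Rightarrow> 'a set \<Rightarrow> 'a set" (infixl "\<ominus>" 65) where
  "X \<ominus> Y = {x. \<forall>y\<in>Y. x - y \<in> X}"

text \<open>The types \<open>'n\<close>, \<open>'p\<close>, \<open>'m\<close>, \<open>'q\<close> index states, inputs, outputs and the steady-state
  parameter \<open>\<theta>\<close>.\<close>

record ('n, 'p, 'm, 'q) rssa =
  sysA :: "real^'n^'n"
  sysB :: "real^'p^'n"
  sysC :: "real^'n^'m"
  sysD :: "real^'p^'m"
  Wset :: "(real^'n) set"
  Xset :: "(real^'n) set"
  Uset :: "(real^'p) set"
  gainK :: "real^'n^'p"
  M1 :: "real^'q^'n"
  M2 :: "real^'q^'p"
  Lmat :: "real^'q^'m"
  ref :: "real^'m"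
  x_des :: "real^'n"
  u_des :: "real^'p"
  Qx :: "real^'n^'n"
  Qu :: "real^'p^'p"
  Qr :: "real^'m^'m"
  Qsx :: "real^'n^'n"
  Qsu :: "real^'p^'p"
  QN :: "real^'n^'n"
  eps :: real
  horizon :: nat

definition steady_state :: "('n::finite, 'p::finite, 'm::finite, 'q::finite) rssa
    \<Rightarrow> real^'n \<Rightarrow> real^'p \<Rightarrow> real^'m \<Rightarrow> bool" where
  "steady_state S xs us \<rho> \<longleftrightarrow>
     xs = sysA S *v xs + sysB S *v us \<and> \<rho> = sysC S *v xs + sysD S *v us"

definition references :: "('n::finite, 'p::finite, 'm::finite, 'q::finite) rssa
    \<Rightarrow> (real^'m) set" where
  "references S = {\<rho>. \<exists>xs\<in>Xset S. \<exists>us\<in>Uset S. steady_state S xs us \<rho>}"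

text \<open>The image of \<open>\<theta> \<mapsto> (M1 \<theta>, M2 \<theta>, L \<theta>)\<close> is a subspace, whereas the admissible
  configurations are bounded; hence every \<open>\<theta>\<close> gives a steady state, and every steady state in
  \<open>X \<times> U\<close> comes from some \<open>\<theta>\<close>.\<close>

definition parameterizes_steady_states ::
    "('n::finite, 'p::finite, 'm::finite, 'q::finite) rssa \<Rightarrow> bool" where
  "parameterizes_steady_states S \<longleftrightarrow>
     (\<forall>\<theta>. steady_state S (M1 S *v \<theta>) (M2 S *v \<theta>) (Lmat S *v \<theta>)) \<and>
     (\<forall>xs\<in>Xset S. \<forall>us\<in>Uset S. \<forall>\<rho>. steady_state S xs us \<rho> \<longrightarrow>
        (\<exists>\<theta>. xs = M1 S *v \<theta> \<and> us = M2 S *v \<theta> \<and> \<rho> = Lmat S *v \<theta>))"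

text \<open>The infinite Minkowski sum is the set of all convergent series with the \<open>i\<close>-th term in
  \<open>(A + B K)^i W\<close>.\<close>

definition Finf :: "('n::finite, 'p::finite, 'm::finite, 'q::finite) rssa \<Rightarrow> (real^'n) set" where
  "Finf S = {e. \<exists>d. (\<forall>i. d i \<in> Wset S) \<and>
     (\<lambda>i. mat_power (sysA S + sysB S ** gainK S) i *v d i) sums e}"

definition tightX :: "('n::finite, 'p::finite, 'm::finite, 'q::finite) rssa
    \<Rightarrow> (real^'n) set" where
  "tightX S = Xset S \<ominus> Finf S"

definition tightU :: "('n::finite, 'p::finite, 'm::finite, 'q::finite) rssa
    \<Rightarrow> (real^'p) set" where
  "tightU S = Uset S \<ominus> ((\<lambda>f. gainK S *v f) ` Finf S)"

definition Kinf :: "('n::finite, 'p::finite, 'm::finite, 'q::finite) rssa \<Rightarrow> real^'n^'p" where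
  "Kinf S = - (matrix_inv (Qu S + transpose (sysB S) ** QN S ** sysB S)
                 ** transpose (sysB S) ** QN S ** sysA S)"

definition riccati :: "('n::finite, 'p::finite, 'm::finite, 'q::finite) rssa \<Rightarrow> bool" where
  "riccati S \<longleftrightarrow>
     QN S = transpose (sysA S) ** QN S ** sysA S
       - (transpose (sysA S) ** QN S ** sysB S)
           ** matrix_inv (Qu S + transpose (sysB S) ** QN S ** sysB S)
           ** (transpose (sysB S) ** QN S ** sysA S)
       + Qx S"

definition terminal_law :: "('n::finite, 'p::finite, 'm::finite, 'q::finite) rssa
    \<Rightarrow> real^'n \<Rightarrow> real^'q \<Rightarrow> real^'p" where
  "terminal_law S x \<theta> = M2 S *v \<theta> + Kinf S *v (x - M1 S *v \<theta>)"

definition terminal_state :: "('n::finite, 'p::finite, 'm::finite, 'q::finite) rssa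
    \<Rightarrow> nat \<Rightarrow> real^'n \<Rightarrow> real^'q \<Rightarrow> real^'n" where
  "terminal_state S \<gamma> x \<theta> =
     mat_power (sysA S + sysB S ** Kinf S) \<gamma> *v x +
     (\<Sum>i=1..\<gamma>. mat_power (sysA S + sysB S ** Kinf S) (i - 1)
                   *v ((sysB S ** M2 S - sysB S ** Kinf S ** M1 S) *v \<theta>))"

definition Oeps :: "('n::finite, 'p::finite, 'm::finite, 'q::finite) rssa
    \<Rightarrow> (real^'q) set" where
  "Oeps S = {\<theta>. M1 S *v \<theta> \<in> (\<lambda>v. (1 - eps S) *\<^sub>R v) ` tightX S \<and>
                M2 S *v \<theta> \<in> (\<lambda>v. (1 - eps S) *\<^sub>R v) ` tightU S}"

definition Oinf :: "('n::finite, 'p::finite, 'm::finite, 'q::finite) rssa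
    \<Rightarrow> ((real^'n) \<times> (real^'q)) set" where
  "Oinf S = {(x, \<theta>). \<forall>\<gamma>. terminal_state S \<gamma> x \<theta> \<in> tightX S \<and>
                          terminal_law S (terminal_state S \<gamma> x \<theta>) \<theta> \<in> tightU S}"

definition Omega :: "('n::finite, 'p::finite, 'm::finite, 'q::finite) rssa
    \<Rightarrow> ((real^'n) \<times> (real^'q)) set" where
  "Omega S = {(x, \<theta>) \<in> Oinf S. \<theta> \<in> Oeps S}"

definition rssa_setting :: "('n::finite, 'p::finite, 'm::finite, 'q::finite) rssa \<Rightarrow> bool" where
  "rssa_setting S \<longleftrightarrow>
     stabilizable (sysA S) (sysB S) \<and>
     bounded (Wset S) \<and>
     convex (Xset S) \<and> compact (Xset S) \<and> 0 \<in> Xset S \<and>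
     convex (Uset S) \<and> compact (Uset S) \<and> 0 \<in> Uset S \<and>
     schur (sysA S + sysB S ** gainK S) \<and>
     parameterizes_steady_states S \<and>
     ref S \<in> references S \<and>
     pos_semidef (Qx S) \<and> pos_def (Qu S) \<and> pos_def (Qr S) \<and>
     pos_semidef (Qsx S) \<and> pos_semidef (Qsu S) \<and>
     pos_semidef (QN S) \<and> riccati S \<and>
     schur (sysA S + sysB S ** Kinf S) \<and>
     0 < eps S \<and> eps S < 1 \<and>
     0 < horizon S"

text \<open>An input sequence is a function on \<open>nat\<close> of which only the values below the horizon are
  used.\<close>

primrec nominal_state :: "('n::finite, 'p::finite, 'm::finite, 'q::finite) rssa
    \<Rightarrow> real^'n \<Rightarrow> (nat \<Rightarrow> real^'p) \<Rightarrow> nat \<Rightarrow> real^'n" where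
  "nominal_state S x0 us 0 = x0"
| "nominal_state S x0 us (Suc k) = sysA S *v nominal_state S x0 us k + sysB S *v us k"

definition mpc_cost :: "('n::finite, 'p::finite, 'm::finite, 'q::finite) rssa
    \<Rightarrow> real^'q \<Rightarrow> real^'n \<Rightarrow> (nat \<Rightarrow> real^'p) \<Rightarrow> real" where
  "mpc_cost S \<theta> x0 us =
     (\<Sum>k<horizon S. wnorm2 (Qx S) (nominal_state S x0 us k - M1 S *v \<theta>)) +
     (\<Sum>k<horizon S. wnorm2 (Qu S) (us k - M2 S *v \<theta>)) +
     wnorm2 (QN S) (nominal_state S x0 us (horizon S) - M1 S *v \<theta>) +
     wnorm2 (Qr S) (ref S - Lmat S *v \<theta>) +
     wnorm2 (Qsx S) (M1 S *v \<theta> - x_des S) +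
     wnorm2 (Qsu S) (M2 S *v \<theta> - u_des S)"

text \<open>Beware of the sign in the initial constraint: the error \<open>e = x0 - x\<close> that is confined to
  \<open>Finf S\<close> evolves in closed loop by \<open>e' = (A + B K) e - w\<close>, so \<open>Finf S\<close> is robustly positively
  invariant for it only if the disturbance set is symmetric about the origin.\<close>

definition mpc_admissible :: "('n::finite, 'p::finite, 'm::finite, 'q::finite) rssa
    \<Rightarrow> real^'n \<Rightarrow> real^'q \<Rightarrow> real^'n \<Rightarrow> (nat \<Rightarrow> real^'p) \<Rightarrow> bool" where
  "mpc_admissible S x \<theta> x0 us \<longleftrightarrow>
     x0 \<in> {x} + Finf S \<and>
     (\<forall>k<horizon S. nominal_state S x0 us k \<in> tightX S \<and> us k \<in> tightU S) \<and>
     (nominal_state S x0 us (horizon S), \<theta>) \<in> Omega S"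

definition mpc_feasible :: "('n::finite, 'p::finite, 'm::finite, 'q::finite) rssa
    \<Rightarrow> real^'n \<Rightarrow> bool" where
  "mpc_feasible S x \<longleftrightarrow> (\<exists>\<theta> x0 us. mpc_admissible S x \<theta> x0 us)"

definition mpc_minimizer :: "('n::finite, 'p::finite, 'm::finite, 'q::finite) rssa
    \<Rightarrow> real^'n \<Rightarrow> real^'q \<Rightarrow> real^'n \<Rightarrow> (nat \<Rightarrow> real^'p) \<Rightarrow> bool" where
  "mpc_minimizer S x \<theta> x0 us \<longleftrightarrow>
     mpc_admissible S x \<theta> x0 us \<and>
     (\<forall>\<theta>' x0' us'. mpc_admissible S x \<theta>' x0' us' \<longrightarrow>
        mpc_cost S \<theta> x0 us \<le> mpc_cost S \<theta>' x0' us')"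

end

theory Submission
  imports Defs
begin

text \<open>Recursive feasibility is proved by shifting the optimal plan. If \<open>(\<theta>, x0, us)\<close> is
  admissible at the current state, then at the next state one keeps \<open>\<theta>\<close>, starts from the predicted
  nominal state \<open>A x0 + B us 0\<close>, drops the first input, and appends the terminal control law.
  Three facts make the shifted plan admissible.

  \<^item> The feedback \<open>K (x - x0)\<close> makes the error \<open>e = x0 - x\<close> evolve by \<open>e' = (A + B K) e - w\<close>.
    Since the disturbance set is symmetric, \<open>- w\<close> is again a disturbance, and \<open>Finf\<close>, being the set
    of all accumulated disturbances, is robustly positively invariant (\<open>Finf_invariant\<close>).

  \<^item> The shifted plan runs through the same nominal states as the old one up to the old final state
    (\<open>nominal_state_shift\<close>), which satisfies the tightened constraints together with its terminal
    input because \<open>Oinf\<close> imposes them at \<open>\<gamma> = 0\<close>.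

  \<^item> \<open>Oinf\<close> demands the constraints along the whole trajectory of the terminal law with \<open>\<theta>\<close>
    frozen, so a state stays in it when it moves one step along that trajectory
    (\<open>Omega_invariant\<close>).\<close>

lemma mat_power_Suc_right: "mat_power M (Suc k) = mat_power M k ** M"
  by (induction k) (simp_all add: matrix_mul_assoc)

text \<open>The new disturbance is inserted in front of the sequence that generates \<open>e\<close>, and applying
  \<open>A + B K\<close> moves every older term one place up in the series.\<close>

lemma Finf_invariant:
  assumes "e \<in> Finf S" and "v \<in> Wset S"
  shows "(sysA S + sysB S ** gainK S) *v e + v \<in> Finf S"
proof -
  let ?A = "sysA S + sysB S ** gainK S"
  obtain d where d: "\<forall>i. d i \<in> Wset S" and sums: "(\<lambda>i. mat_power ?A i *v d i) sums e"
    using assms(1) by (auto simp: Finf_def)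
  let ?d = "case_nat v d"
  have "(\<lambda>i. ?A *v (mat_power ?A i *v d i)) sums (?A *v e)"
    using sums by (rule bounded_linear.sums[OF matrix_vector_mul_bounded_linear])
  then have "(\<lambda>i. mat_power ?A (Suc i) *v ?d (Suc i)) sums (?A *v e)"
    by (simp add: matrix_vector_mul_assoc)
  then have "(\<lambda>i. mat_power ?A i *v ?d i) sums (?A *v e + mat_power ?A 0 *v ?d 0)"
    by (rule sums_Suc)
  then have "(\<lambda>i. mat_power ?A i *v ?d i) sums (?A *v e + v)"
    by simp
  moreover have "\<forall>i. ?d i \<in> Wset S"
    using d assms(2) by (auto split: nat.split)
  ultimately show ?thesis
    unfolding Finf_def by blast
qed

lemma terminal_state_0 [simp]: "terminal_state S 0 x \<theta> = x"
  by (simp add: terminal_state_def)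

lemma terminal_state_1:
  "terminal_state S 1 x \<theta> = sysA S *v x + sysB S *v terminal_law S x \<theta>"
  by (simp add: terminal_state_def terminal_law_def algebra_simps matrix_vector_mul_assoc
      matrix_vector_mult_diff_rdistrib matrix_vector_mult_add_rdistrib
      matrix_vector_right_distrib matrix_vector_mult_diff_distrib matrix_mul_assoc)

text \<open>The closed form of the predicted states obeys the semigroup law of the terminal dynamics.\<close>

lemma terminal_state_Suc:
  "terminal_state S \<gamma> (terminal_state S 1 x \<theta>) \<theta> = terminal_state S (Suc \<gamma>) x \<theta>"
proof -
  define F where "F = sysA S + sysB S ** Kinf S"
  define c where "c = (sysB S ** M2 S - sysB S ** Kinf S ** M1 S) *v \<theta>"
  have state: "terminal_state S k z \<theta> = mat_power F k *v z + (\<Sum>i=1..k. mat_power F (i - 1) *v c)"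
    for k z
    by (simp only: terminal_state_def F_def c_def)
  show ?thesis
    by (simp add: state mat_power_Suc_right matrix_vector_right_distrib matrix_vector_mul_assoc
        add.assoc add.commute del: mat_power.simps(2))
qed

lemma Omega_invariant:
  assumes "(x, \<theta>) \<in> Omega S"
  shows "(sysA S *v x + sysB S *v terminal_law S x \<theta>, \<theta>) \<in> Omega S"
  using assms unfolding Omega_def Oinf_def terminal_state_1[symmetric]
  by (auto simp: terminal_state_Suc simp del: One_nat_def)

lemma Omega_constraints:
  assumes "(x, \<theta>) \<in> Omega S"
  shows "x \<in> tightX S" and "terminal_law S x \<theta> \<in> tightU S"
proof -
  have "terminal_state S 0 x \<theta> \<in> tightX S \<and>
      terminal_law S (terminal_state S 0 x \<theta>) \<theta> \<in> tightU S"
    using assms unfolding Omega_def Oinf_def by blast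
  then show "x \<in> tightX S" and "terminal_law S x \<theta> \<in> tightU S"
    by simp_all
qed

lemma nominal_state_shift:
  assumes "\<And>j. j < k \<Longrightarrow> vs j = us (Suc j)"
  shows "nominal_state S (nominal_state S x0 us 1) vs k = nominal_state S x0 us (Suc k)"
  using assms by (induction k) simp_all

lemma mpc_feasible_step:
  assumes horizon: "0 < horizon S"
    and W_symmetric: "\<forall>v\<in>Wset S. - v \<in> Wset S"
    and w: "w \<in> Wset S"
    and adm: "mpc_admissible S x \<theta> x0 us"
    and x': "x' = sysA S *v x + sysB S *v (us 0 + gainK S *v (x - x0)) + w"
  shows "mpc_feasible S x'"
proof -
  obtain n where n: "horizon S = Suc n"
    using horizon by (cases "horizon S") auto
  let ?x0 = "nominal_state S x0 us 1"
  let ?xN = "nominal_state S x0 us (horizon S)"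
  let ?vs = "\<lambda>k. if k < n then us (Suc k) else terminal_law S ?xN \<theta>"
  have e: "x0 - x \<in> Finf S"
    using adm by (auto simp: mpc_admissible_def set_plus_def)
  have constr: "nominal_state S x0 us k \<in> tightX S" "us k \<in> tightU S" if "k < horizon S" for k
    using adm that by (auto simp: mpc_admissible_def)
  have Om: "(?xN, \<theta>) \<in> Omega S"
    using adm by (simp add: mpc_admissible_def)
  have shift: "nominal_state S ?x0 ?vs k = nominal_state S x0 us (Suc k)" if "k \<le> n" for k
    using that by (intro nominal_state_shift) auto
  have "?x0 - x' = (sysA S + sysB S ** gainK S) *v (x0 - x) + (- w)"
    by (simp add: x' algebra_simps matrix_vector_mul_assoc matrix_vector_mult_add_rdistrib
        matrix_vector_right_distrib matrix_vector_mult_diff_distrib)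
  also have "\<dots> \<in> Finf S"
    using e W_symmetric w by (intro Finf_invariant) auto
  finally have init: "?x0 \<in> {x'} + Finf S"
    using set_plus_intro[of x' "{x'}" "?x0 - x'" "Finf S"] by simp
  have stage: "nominal_state S ?x0 ?vs k \<in> tightX S \<and> ?vs k \<in> tightU S"
    if "k < horizon S" for k
  proof (cases "k < n")
    case True
    then show ?thesis
      using constr[of "Suc k"] shift[of k] n by simp
  next
    case False
    then have "k = n"
      using that n by simp
    then show ?thesis
      using Omega_constraints[OF Om] shift[of n] n by simp
  qed
  have "nominal_state S ?x0 ?vs (horizon S) = sysA S *v ?xN + sysB S *v terminal_law S ?xN \<theta>"
    using shift[of n] n by simp
  then have final: "(nominal_state S ?x0 ?vs (horizon S), \<theta>) \<in> Omega S"
    using Omega_invariant[OF Om] by simp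
  have "mpc_admissible S x' \<theta> ?x0 ?vs"
    unfolding mpc_admissible_def using init stage final by blast
  then show ?thesis
    unfolding mpc_feasible_def by blast
qed

theorem mainTheorem1:
  fixes S :: "('n::finite, 'p::finite, 'm::finite, 'q::finite) rssa"
    and x w :: "nat \<Rightarrow> real^'n" and u :: "nat \<Rightarrow> real^'p" and y :: "nat \<Rightarrow> real^'m"
    and \<theta>_opt :: "nat \<Rightarrow> real^'q" and x0_opt :: "nat \<Rightarrow> real^'n"
    and u_opt :: "nat \<Rightarrow> nat \<Rightarrow> real^'p"
    and t0 :: nat
  assumes setting: "rssa_setting S"
    and W_symmetric: "\<forall>v\<in>Wset S. - v \<in> Wset S"
    and disturbance: "\<forall>t. w t \<in> Wset S"
    and dynamics: "\<forall>t. x (Suc t) = sysA S *v x t + sysB S *v u t + w t"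
    and system_output: "\<forall>t. y t = sysC S *v x t + sysD S *v u t"
    and optimizer: "\<forall>t. mpc_feasible S (x t) \<longrightarrow>
                      mpc_minimizer S (x t) (\<theta>_opt t) (x0_opt t) (u_opt t)"
    and control_law: "\<forall>t. mpc_feasible S (x t) \<longrightarrow>
                      u t = u_opt t 0 + gainK S *v (x t - x0_opt t)"
    and initially_feasible: "mpc_feasible S (x t0)"
  shows "\<forall>t\<ge>t0. mpc_feasible S (x t)"
proof (intro allI impI)
  fix t
  assume "t0 \<le> t"
  then show "mpc_feasible S (x t)"
  proof (induction t rule: dec_induct)
    case base
    show ?case by (rule initially_feasible)
  next
    case (step t)
    have "mpc_admissible S (x t) (\<theta>_opt t) (x0_opt t) (u_opt t)"
      using optimizer step.IH by (simp add: mpc_minimizer_def)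
    moreover have "x (Suc t) = sysA S *v x t
        + sysB S *v (u_opt t 0 + gainK S *v (x t - x0_opt t)) + w t"
      using dynamics control_law step.IH by simp
    moreover have "0 < horizon S"
      using setting by (simp add: rssa_setting_def)
    ultimately show ?case
      using W_symmetric disturbance by (intro mpc_feasible_step) auto
  qed
qed

end
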